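(* Let $X$ be an absolutely continuous, non-negative random variable with unbounded support and $\mathbb{E}X<+\infty$. If $\lim_{x\to+\infty}\mathrm{g}(x)$ exists and is equal to $\kappa$ with $1<\kappa\le+\infty$, then $$\lim_{x\to+\infty}\ell(x)=\frac{1}{\kappa-1},$$ where the right-hand side is understood as $0$ if $\kappa=+\infty$.
   Context: Let $F$ be the distribution function of $X$, $\bar F:=1-F$, and $f$ its density ($F'=f$ almost everywhere). Unbounded support means $F(x)<1$ for all $x\geq 0$. The generalized failure rate (GFR) function is $\mathrm{g}(x):=x f(x)/\bar F(x)$. The generalized mean residual demand (GMRD) function is $\ell(x):=\frac{1}{x\bar F(x)}\int_x^{+\infty}\bar F(u)\,du$ for $x>0$. *)

theory Defs
  imports "HOL-Probability.Probability"
begin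

definition distribution_function :: "'a measure \<Rightarrow> ('a \<Rightarrow> real) \<Rightarrow> real \<Rightarrow> real" where
  "distribution_function M X = cdf (distr M borel X)"

definition survival_function :: "'a measure \<Rightarrow> ('a \<Rightarrow> real) \<Rightarrow> real \<Rightarrow> real" where
  "survival_function M X x = 1 - distribution_function M X x"

text \<open>
  A random variable is absolutely continuous when it has a density with respect to Lebesgue
  measure. The density is only determined almost everywhere, whereas the failure rate below is a
  pointwise expression in it, so the version \<open>f\<close> of the density is an explicit parameter. A version
  may take negative values on a null set; \<open>ennreal\<close> truncates them to zero, and the second
  conjunct excludes negative values on a set of positive measure.
\<close>

definition has_density :: "'a measure \<Rightarrow> ('a \<Rightarrow> real) \<Rightarrow> (real \<Rightarrow> real) \<Rightarrow> bool" where
  "has_density M X f \<longleftrightarrow>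
     distributed M lborel X (\<lambda>x. ennreal (f x)) \<and> (AE x in lborel. 0 \<le> f x)"

definition generalized_failure_rate :: "'a measure \<Rightarrow> ('a \<Rightarrow> real) \<Rightarrow> (real \<Rightarrow> real) \<Rightarrow> real \<Rightarrow> real" where
  "generalized_failure_rate M X f x = x * f x / survival_function M X x"

text \<open>
  The value is meaningful for \<open>x > 0\<close> with positive survival function; the
  integral is finite when \<open>X\<close> is non-negative with finite expectation.
\<close>

definition generalized_mean_residual_demand :: "'a measure \<Rightarrow> ('a \<Rightarrow> real) \<Rightarrow> real \<Rightarrow> real" where
  "generalized_mean_residual_demand M X x =
     1 / (x * survival_function M X x) * (LBINT u:{x..}. survival_function M X u)"

end

theory Submission
  imports Defs
begin

text \<open>
  Write \<open>S\<close> for the survival function and \<open>H(x)\<close> for the integral of \<open>S\<close> over \<open>[x, \<infinity>)\<close>, so that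
  the generalized mean residual demand is \<open>H(x) / (x S(x))\<close>. By Tonelli's theorem \<open>H(x)\<close> is the
  expectation of the positive part of \<open>X - x\<close>, and splitting \<open>X = x + (X - x)\<close> on the event
  \<open>X > x\<close> gives, for \<open>x \<ge> 0\<close>, the identity that carries the proof: the integral of \<open>u f(u)\<close> over
  \<open>(x, \<infinity>)\<close> equals \<open>x S(x) + H(x)\<close> (lemma \<open>nn_integral_density_tail\<close>).

  If the generalized failure rate is at least \<open>a > 1\<close> on \<open>[x, \<infinity>)\<close>, then \<open>u f(u) \<ge> a S(u)\<close> there,
  and integrating yields \<open>a H(x) \<le> x S(x) + H(x)\<close>, that is, a generalized mean residual demand of
  at most \<open>1 / (a - 1)\<close>. An upper bound \<open>b > 1\<close> on the generalized failure rate gives in the same way the lower bound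
  \<open>1 / (b - 1)\<close>. Letting \<open>a\<close> and \<open>b\<close> tend to \<open>\<kappa>\<close> (for infinite \<open>\<kappa>\<close>, the lower bound being \<open>0\<close>)
  gives the limit. The density occurs only under the integral sign, so \<open>S\<close> is never differentiated
  and the choice of the version of the density matters only through the assumed limit.
\<close>

lemma (in real_distribution) survival_eq_measure:
  "1 - cdf M u = measure M {u<..}"
proof -
  have "measure M {u<..} = measure M (space M - {..u})"
    by (rule arg_cong[where f = "measure M"]) auto
  also have "\<dots> = 1 - cdf M u"
    unfolding cdf_def by (rule prob_compl) simp
  finally show ?thesis ..
qed

lemma (in real_distribution) borel_measurable_survival [measurable]:
  "(\<lambda>u. measure M {u<..}) \<in> borel_measurable borel"
  unfolding survival_eq_measure[symmetric]
  by (intro borel_measurable_diff borel_measurable_const borel_measurable_mono monoI cdf_nondecreasing)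

text \<open>The right-hand side is the expectation of the positive part of \<open>y - x\<close>, since \<open>ennreal\<close>
  truncates negative values to zero.\<close>

lemma (in real_distribution) nn_integral_survival:
  "(\<integral>\<^sup>+u\<in>{x..}. ennreal (measure M {u<..}) \<partial>lborel) = (\<integral>\<^sup>+y. ennreal (y - x) \<partial>M)"
proof -
  interpret pair_sigma_finite M lborel
    by (rule pair_sigma_finite.intro; unfold_locales)
  have "(\<integral>\<^sup>+u\<in>{x..}. ennreal (measure M {u<..}) \<partial>lborel)
      = (\<integral>\<^sup>+u. (\<integral>\<^sup>+y. indicator {(y, u). x \<le> u \<and> u < y} (y, u) \<partial>M) \<partial>lborel)"
  proof (rule nn_integral_cong)
    fix u :: real
    have "(\<integral>\<^sup>+y. indicator {(y, u). x \<le> u \<and> u < y} (y, u) \<partial>M)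
        = (\<integral>\<^sup>+y. indicator {x..} u * indicator {u<..} y \<partial>M)"
      by (intro nn_integral_cong) (auto split: split_indicator)
    also have "\<dots> = indicator {x..} u * emeasure M {u<..}"
      by (simp add: nn_integral_cmult)
    finally show "ennreal (measure M {u<..}) * indicator {x..} u
        = (\<integral>\<^sup>+y. indicator {(y, u). x \<le> u \<and> u < y} (y, u) \<partial>M)"
      by (simp add: emeasure_eq_measure mult.commute)
  qed
  also have "\<dots> = (\<integral>\<^sup>+y. (\<integral>\<^sup>+u. indicator {(y, u). x \<le> u \<and> u < y} (y, u) \<partial>lborel) \<partial>M)"
    by (rule Fubini') measurable
  also have "\<dots> = (\<integral>\<^sup>+y. ennreal (y - x) \<partial>M)"
  proof (rule nn_integral_cong)
    fix y :: real
    have "(\<integral>\<^sup>+u. indicator {(y, u). x \<le> u \<and> u < y} (y, u) \<partial>lborel)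
        = (\<integral>\<^sup>+u. indicator {x..<y} u \<partial>lborel)"
      by (intro nn_integral_cong) (auto split: split_indicator)
    also have "\<dots> = ennreal (y - x)"
      by (cases "x \<le> y") (auto simp: ennreal_neg)
    finally show "(\<integral>\<^sup>+u. indicator {(y, u). x \<le> u \<and> u < y} (y, u) \<partial>lborel) = ennreal (y - x)" .
  qed
  finally show ?thesis .
qed

text \<open>Only the truncation of \<open>f\<close> at zero is required to be measurable, and negative values of \<open>f\<close>
  contribute nothing to either occurrence of \<open>f\<close>.\<close>

lemma (in real_distribution) nn_integral_density_tail:
  assumes dens: "M = density lborel (\<lambda>x. ennreal (f x))"
    and f [measurable]: "(\<lambda>x. ennreal (f x)) \<in> borel_measurable borel"
    and x: "0 \<le> x"
  shows "(\<integral>\<^sup>+u\<in>{x<..}. ennreal (u * f u) \<partial>lborel)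
       = ennreal (x * measure M {x<..}) + (\<integral>\<^sup>+u\<in>{x..}. ennreal (measure M {u<..}) \<partial>lborel)"
proof -
  have "(\<integral>\<^sup>+u\<in>{x<..}. ennreal (u * f u) \<partial>lborel)
      = (\<integral>\<^sup>+u. ennreal (f u) * (ennreal u * indicator {x<..} u) \<partial>lborel)"
    using x by (intro nn_integral_cong) (auto simp: ennreal_mult' mult.commute split: split_indicator)
  also have "\<dots> = (\<integral>\<^sup>+u. ennreal u * indicator {x<..} u \<partial>M)"
    by (subst dens, subst nn_integral_density) auto
  also have "\<dots> = (\<integral>\<^sup>+u. ennreal x * indicator {x<..} u + ennreal (u - x) \<partial>M)"
    using x by (intro nn_integral_cong)
      (auto simp: ennreal_plus[symmetric] ennreal_neg simp del: ennreal_plus split: split_indicator)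
  also have "\<dots> = ennreal x * emeasure M {x<..} + (\<integral>\<^sup>+u. ennreal (u - x) \<partial>M)"
    by (simp add: nn_integral_add nn_integral_cmult)
  also have "ennreal x * emeasure M {x<..} = ennreal (x * measure M {x<..})"
    using x by (simp add: emeasure_eq_measure ennreal_mult)
  finally show ?thesis
    by (simp add: nn_integral_survival)
qed

text \<open>Integrability makes the tail integral finite, so that the two kinds of integral agree and the
  extended-valued inequalities below can be read as inequalities between reals.\<close>

lemma (in real_distribution) ennreal_survival_integral:
  assumes int: "integrable M (\<lambda>y. y)" and x: "0 \<le> x"
  shows "(\<integral>\<^sup>+u\<in>{x..}. ennreal (measure M {u<..}) \<partial>lborel)
       = ennreal (LBINT u:{x..}. measure M {u<..})"
proof -
  have "(\<integral>\<^sup>+u\<in>{x..}. ennreal (measure M {u<..}) \<partial>lborel) \<le> (\<integral>\<^sup>+y. ennreal (norm y) \<partial>M)"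
    unfolding nn_integral_survival using x by (intro nn_integral_mono ennreal_leI) auto
  also have "\<dots> < \<infinity>"
    using int by (simp add: integrable_iff_bounded)
  finally have fin: "(\<integral>\<^sup>+u\<in>{x..}. ennreal (measure M {u<..}) \<partial>lborel) < \<infinity>" .
  have eq: "(\<integral>\<^sup>+u\<in>{x..}. ennreal (measure M {u<..}) \<partial>lborel)
      = (\<integral>\<^sup>+u. ennreal (indicator {x..} u *\<^sub>R measure M {u<..}) \<partial>lborel)"
    by (intro nn_integral_cong) (auto split: split_indicator)
  show ?thesis
    unfolding set_lebesgue_integral_def
    by (subst integral_eq_nn_integral) (use fin eq in auto)
qed

lemma (in real_distribution) residual_demand_le:
  assumes dens: "M = density lborel (\<lambda>x. ennreal (f x))"
    and f [measurable]: "(\<lambda>x. ennreal (f x)) \<in> borel_measurable borel"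
    and int: "integrable M (\<lambda>y. y)"
    and x: "0 < x" and pos: "0 < measure M {x<..}" and a: "1 < a"
    and bound: "\<And>u. x \<le> u \<Longrightarrow> a * measure M {u<..} \<le> u * f u"
  shows "1 / (x * measure M {x<..}) * (LBINT u:{x..}. measure M {u<..}) \<le> 1 / (a - 1)"
proof -
  let ?H = "LBINT u:{x..}. measure M {u<..}"
  have H: "0 \<le> ?H"
    by (auto simp: set_lebesgue_integral_def intro!: integral_nonneg_AE)
  have "ennreal (a * ?H) = (\<integral>\<^sup>+u. ennreal a * (ennreal (measure M {u<..}) * indicator {x..} u) \<partial>lborel)"
    by (subst nn_integral_cmult) (use a x H in \<open>auto simp: ennreal_survival_integral[OF int] ennreal_mult\<close>)
  also have "\<dots> \<le> (\<integral>\<^sup>+u\<in>{x<..}. ennreal (u * f u) \<partial>lborel)"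
    \<comment> \<open>The two half-lines differ by the null set \<open>{x}\<close>.\<close>
    using AE_lborel_singleton[of x] a bound
    by (intro nn_integral_mono_AE)
       (auto elim!: eventually_mono simp: ennreal_mult[symmetric] intro!: ennreal_leI split: split_indicator)
  also have "\<dots> = ennreal (x * measure M {x<..} + ?H)"
    using x H by (simp add: nn_integral_density_tail[OF dens f] ennreal_survival_integral[OF int])
  finally have "a * ?H \<le> x * measure M {x<..} + ?H"
    using x H by (subst (asm) ennreal_le_iff) auto
  then show ?thesis
    using x pos a by (simp add: field_simps)
qed

lemma (in real_distribution) residual_demand_ge:
  assumes dens: "M = density lborel (\<lambda>x. ennreal (f x))"
    and f [measurable]: "(\<lambda>x. ennreal (f x)) \<in> borel_measurable borel"
    and int: "integrable M (\<lambda>y. y)"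
    and x: "0 < x" and pos: "0 < measure M {x<..}" and b: "1 < b"
    and bound: "\<And>u. x \<le> u \<Longrightarrow> u * f u \<le> b * measure M {u<..}"
  shows "1 / (b - 1) \<le> 1 / (x * measure M {x<..}) * (LBINT u:{x..}. measure M {u<..})"
proof -
  let ?H = "LBINT u:{x..}. measure M {u<..}"
  have H: "0 \<le> ?H"
    by (auto simp: set_lebesgue_integral_def intro!: integral_nonneg_AE)
  have "ennreal (x * measure M {x<..} + ?H) = (\<integral>\<^sup>+u\<in>{x<..}. ennreal (u * f u) \<partial>lborel)"
    using x H by (simp add: nn_integral_density_tail[OF dens f] ennreal_survival_integral[OF int])
  also have "\<dots> \<le> (\<integral>\<^sup>+u. ennreal b * (ennreal (measure M {u<..}) * indicator {x..} u) \<partial>lborel)"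
    using b bound
    by (intro nn_integral_mono)
       (auto simp: ennreal_mult[symmetric] intro!: ennreal_leI split: split_indicator)
  also have "\<dots> = ennreal (b * ?H)"
    by (subst nn_integral_cmult) (use b x H in \<open>auto simp: ennreal_survival_integral[OF int] ennreal_mult\<close>)
  finally have "x * measure M {x<..} + ?H \<le> b * ?H"
    using b H by (subst (asm) ennreal_le_iff) auto
  then show ?thesis
    using x pos b by (simp add: field_simps)
qed

theorem theorem3p5:
  fixes M :: "'a measure" and X :: "'a \<Rightarrow> real" and f :: "real \<Rightarrow> real" and \<kappa> :: ereal
  assumes "prob_space M"
    and "has_density M X f"
    and "AE \<omega> in M. 0 \<le> X \<omega>"
    and "\<forall>x\<ge>0. distribution_function M X x < 1"
    and "integrable M X"
    and "((\<lambda>x. ereal (generalized_failure_rate M X f x)) \<longlongrightarrow> \<kappa>) at_top"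
    and "1 < \<kappa>"
  shows "(generalized_mean_residual_demand M X \<longlongrightarrow> (if \<kappa> = \<infinity> then 0 else 1 / (real_of_ereal \<kappa> - 1))) at_top"
proof -
  define D where "D = distr M borel X"
  have X [measurable]: "X \<in> borel_measurable M"
    using assms(5) by auto
  interpret prob_space M by fact
  interpret D: real_distribution D
    unfolding D_def by (rule real_distribution_distr) simp
  have dist: "distributed M lborel X (\<lambda>x. ennreal (f x))"
    using assms(2) by (simp add: has_density_def)
  have f [measurable]: "(\<lambda>x. ennreal (f x)) \<in> borel_measurable borel"
    using distributed_borel_measurable[OF dist] by simp
  have dens: "D = density lborel (\<lambda>x. ennreal (f x))"
    unfolding D_def distributed_distr_eq_density[OF dist, symmetric]
    by (rule distr_cong) auto
  have int: "integrable D (\<lambda>y. y)"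
    unfolding D_def by (subst integrable_distr_eq) (use assms(5) in auto)
  have S: "survival_function M X = (\<lambda>u. measure D {u<..})"
    by (rule ext) (simp add: survival_function_def distribution_function_def
        D_def[symmetric] D.survival_eq_measure)
  have pos: "0 < measure D {u<..}" if "0 \<le> u" for u
    using assms(4) that S[symmetric] by (metis diff_gt_0_iff_gt survival_function_def)
  let ?g = "generalized_failure_rate M X f"
  let ?l = "generalized_mean_residual_demand M X"
  have l_def: "?l x = 1 / (x * measure D {x<..}) * (LBINT u:{x..}. measure D {u<..})" for x
    by (simp add: generalized_mean_residual_demand_def S)
  have upper: "eventually (\<lambda>x. ?l x \<le> 1 / (a - 1)) at_top" if a: "1 < a" "ereal a < \<kappa>" for a
  proof -
    have "eventually (\<lambda>x. ereal a < ereal (?g x)) at_top"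
      using assms(6) a(2) by (rule order_tendstoD)
    then obtain N where N: "\<And>u. N \<le> u \<Longrightarrow> a < ?g u"
      by (auto simp: eventually_at_top_linorder)
    have "?l x \<le> 1 / (a - 1)" if "max 1 N \<le> x" for x
      unfolding l_def
    proof (rule D.residual_demand_le[OF dens f int])
      fix u assume "x \<le> u"
      with that N[of u] pos[of u] show "a * measure D {u<..} \<le> u * f u"
        by (simp add: generalized_failure_rate_def S field_simps)
    qed (use that pos[of x] a in auto)
    then show ?thesis
      by (rule eventually_at_top_linorderI)
  qed
  have lower: "eventually (\<lambda>x. 1 / (b - 1) \<le> ?l x) at_top" if b: "\<kappa> < ereal b" for b
  proof -
    have "eventually (\<lambda>x. ereal (?g x) < ereal b) at_top"
      using assms(6) b by (rule order_tendstoD)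
    then obtain N where N: "\<And>u. N \<le> u \<Longrightarrow> ?g u < b"
      by (auto simp: eventually_at_top_linorder)
    have "1 < ereal b"
      using assms(7) b by (rule less_trans)
    then have "1 < b"
      by simp
    have "1 / (b - 1) \<le> ?l x" if "max 1 N \<le> x" for x
      unfolding l_def
    proof (rule D.residual_demand_ge[OF dens f int])
      fix u assume "x \<le> u"
      with that N[of u] pos[of u] show "u * f u \<le> b * measure D {u<..}"
        by (simp add: generalized_failure_rate_def S field_simps)
    qed (use that pos[of x] \<open>1 < b\<close> in auto)
    then show ?thesis
      by (rule eventually_at_top_linorderI)
  qed
  show ?thesis
  proof (cases \<kappa>)
    case (real k)
    with assms(7) have k: "1 < k"
      by simp
    have "(?l \<longlongrightarrow> 1 / (k - 1)) at_top"
    proof (rule order_tendstoI)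
      fix c assume c: "c < 1 / (k - 1)"
      have "((\<lambda>b. 1 / (b - 1)) \<longlongrightarrow> 1 / (k - 1)) (at_right k)"
        using k by (intro tendsto_intros) auto
      then have "eventually (\<lambda>b. c < 1 / (b - 1) \<and> k < b) (at_right k)"
        using c by (intro eventually_conj order_tendstoD eventually_at_right_less) auto
      then obtain b where "c < 1 / (b - 1)" "k < b"
        using eventually_happens trivial_limit_at_right_real by blast
      with lower[of b] real show "eventually (\<lambda>x. c < ?l x) at_top"
        by (auto elim!: eventually_mono)
    next
      fix c assume c: "1 / (k - 1) < c"
      have "((\<lambda>a. 1 / (a - 1)) \<longlongrightarrow> 1 / (k - 1)) (at_left k)"
        using k by (intro tendsto_intros) auto
      then have "eventually (\<lambda>a. 1 / (a - 1) < c \<and> a \<in> {1<..<k}) (at_left k)"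
        using c k by (intro eventually_conj order_tendstoD eventually_at_left_real) auto
      then obtain a where "1 / (a - 1) < c" "a \<in> {1<..<k}"
        using eventually_happens trivial_limit_at_left_real by blast
      with upper[of a] real show "eventually (\<lambda>x. ?l x < c) at_top"
        by (auto elim!: eventually_mono)
    qed
    with real show ?thesis
      by simp
  next
    case PInf
    have "(?l \<longlongrightarrow> 0) at_top"
    proof (rule order_tendstoI)
      fix c :: real assume "c < 0"
      moreover have "0 \<le> ?l x" if "0 \<le> x" for x
        unfolding l_def using that
        by (auto simp: set_lebesgue_integral_def intro!: mult_nonneg_nonneg divide_nonneg_nonneg integral_nonneg_AE)
      ultimately show "eventually (\<lambda>x. c < ?l x) at_top"
        by (intro eventually_mono[OF eventually_ge_at_top[of 0]]) (meson less_le_trans)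
    next
      fix c :: real assume "0 < c"
      \<comment> \<open>The value \<open>a = 1 + 2 / c\<close> makes the upper bound \<open>1 / (a - 1)\<close> equal to \<open>c / 2\<close>.\<close>
      then show "eventually (\<lambda>x. ?l x < c) at_top"
        using upper[of "1 + 2 / c"] PInf by (auto elim!: eventually_mono)
    qed
    with PInf show ?thesis
      by simp
  qed (use assms(7) in auto)
qed

end
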